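(* Let $k$ be a field, $R=k[x_1,\dots,x_n]$, and let $I$ be a monomial ideal of $R$ such that $\dim_k(R/I)<\infty$. Let $M=R/I$, regarded as an $R$-module. Let $S$ be the collection of all outside corner elements of $M$ and let $\langle S\rangle_k$ be the $k$-submodule of $M$ generated by $S$. Then $$\langle S\rangle_k=\mathfrak{R}(M)=\mathrm{Soc}(M).$$
   Context: An element $m\in M$ is an outside corner element if $x_i m=0$ for all $1\le i\le n$. For an $R$-module $M$, $\mathfrak{R}(M)$ denotes the set $\mathfrak{R}(M)=\{m\in M : \text{for all } a\in R,\ a^2m=0 \Rightarrow am=0\}$ (for a general module this need not be a submodule). For $M=R/I$ as in the claim, $\mathrm{Soc}(M)$ is the submodule $(0:_M\mathbf{m})=\{m\in M:\mathbf{m}m=0\}$ with $\mathbf{m}=\langle x_1,\dots,x_n\rangle$; equivalently, the sum of all simple submodules of $M$. *)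

theory Defs
  imports
    "HOL-Algebra.QuotRing"
    "HOL-Algebra.Module"
    "HOL-Library.Poly_Mapping"
    "Jordan_Normal_Form.VS_Connect"
begin

section \<open>The polynomial ring in \<open>n\<close> variables over a field\<close>

text \<open>A polynomial maps exponent vectors to coefficients, both with finite support;
  the arithmetic of \<^typ>\<open>(nat \<Rightarrow>\<^sub>0 nat) \<Rightarrow>\<^sub>0 'k\<close> is the usual convolution.  The number
  \<open>n\<close> of variables is a term: the carrier consists of those polynomials in which only
  variables with an index in \<open>{1..n}\<close> occur.  The field \<open>k\<close> is a type of class \<open>field\<close>,
  viewed as a ring record through \<^term>\<open>class_ring\<close>.\<close>

type_synonym 'k mpoly = "(nat \<Rightarrow>\<^sub>0 nat) \<Rightarrow>\<^sub>0 'k"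

definition mpoly_ring :: "nat \<Rightarrow> 'k::field mpoly ring" where
  "mpoly_ring n =
    \<lparr>carrier = {p. \<forall>t\<in>Poly_Mapping.keys p. Poly_Mapping.keys t \<subseteq> {1..n}},
     mult = (*), one = 1, zero = 0, add = (+)\<rparr>"

definition mconst :: "'k::field \<Rightarrow> 'k mpoly" where
  "mconst c = Poly_Mapping.single 0 c"

definition mvar :: "nat \<Rightarrow> 'k::field mpoly" where
  "mvar i = Poly_Mapping.single (Poly_Mapping.single i 1) 1"

definition monomials :: "nat \<Rightarrow> 'k::field mpoly set" where
  "monomials n = {Poly_Mapping.single t 1 |t. Poly_Mapping.keys t \<subseteq> {1..n}}"

definition monomial_ideal :: "nat \<Rightarrow> 'k::field mpoly set \<Rightarrow> bool" where
  "monomial_ideal n I \<longleftrightarrow> (\<exists>G \<subseteq> monomials n. I = Idl\<^bsub>mpoly_ring n\<^esub> G)"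

lemma cring_mpoly_ring: "cring (mpoly_ring n :: 'k::field mpoly ring)"
proof -
  let ?R = "mpoly_ring n :: 'k mpoly ring"
  have add: "p + q \<in> carrier ?R" if "p \<in> carrier ?R" "q \<in> carrier ?R" for p q
    using that keys_add[of p q] unfolding mpoly_ring_def by fastforce
  have uminus: "- p \<in> carrier ?R" if "p \<in> carrier ?R" for p
    using that by (simp add: mpoly_ring_def)
  have mult: "p * q \<in> carrier ?R" if "p \<in> carrier ?R" "q \<in> carrier ?R" for p q
  proof -
    have "Poly_Mapping.keys t \<subseteq> {1..n}" if t: "t \<in> Poly_Mapping.keys (p * q)" for t
    proof -
      obtain a b where ab: "t = a + b" "a \<in> Poly_Mapping.keys p" "b \<in> Poly_Mapping.keys q"
        using t keys_mult[of p q] by blast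
      moreover have "Poly_Mapping.keys a \<subseteq> {1..n}" "Poly_Mapping.keys b \<subseteq> {1..n}"
        using ab \<open>p \<in> carrier ?R\<close> \<open>q \<in> carrier ?R\<close> by (auto simp: mpoly_ring_def)
      ultimately show ?thesis using keys_add[of a b] by blast
    qed
    then show ?thesis by (simp add: mpoly_ring_def)
  qed
  have zero: "0 \<in> carrier ?R" and one: "1 \<in> carrier ?R"
    by (auto simp: mpoly_ring_def)
  have ops: "mult ?R = (*)" "add ?R = (+)" "\<one>\<^bsub>?R\<^esub> = 1" "\<zero>\<^bsub>?R\<^esub> = 0"
    by (simp_all add: mpoly_ring_def)
  have "abelian_group ?R"
  proof (rule abelian_groupI)
    fix x assume "x \<in> carrier ?R"
    then show "\<exists>y\<in>carrier ?R. y \<oplus>\<^bsub>?R\<^esub> x = \<zero>\<^bsub>?R\<^esub>"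
      using uminus by (intro bexI[of _ "- x"]) (simp_all add: ops)
  qed (simp_all add: ops add zero ac_simps)
  moreover have "Group.comm_monoid ?R"
    by (rule comm_monoidI) (simp_all add: ops mult one ac_simps)
  ultimately show ?thesis
    by (rule cringI) (simp add: ops distrib_right)
qed


section \<open>The module \<open>R/I\<close> and its underlying vector space\<close>

definition quotient_module :: "('a, 'b) ring_scheme \<Rightarrow> 'a set \<Rightarrow> ('a, 'a set) module" where
  "quotient_module R I =
    \<lparr>carrier = carrier (R Quot I), mult = mult (R Quot I), one = one (R Quot I),
     zero = zero (R Quot I), add = add (R Quot I),
     smult = (\<lambda>a X. (I +>\<^bsub>R\<^esub> a) \<otimes>\<^bsub>R Quot I\<^esub> X)\<rparr>"

definition restrict_scalars ::
    "('k \<Rightarrow> 'a) \<Rightarrow> ('a, 'm, 'c) module_scheme \<Rightarrow> ('k, 'm) module" where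
  "restrict_scalars h M =
    \<lparr>carrier = carrier M, mult = mult M, one = one M, zero = zero M, add = add M,
     smult = (\<lambda>c m. h c \<odot>\<^bsub>M\<^esub> m)\<rparr>"

lemma module_quotient_module:
  assumes "cring R" and "ideal I R"
  shows "module R (quotient_module R I)"
proof -
  interpret R: cring R by fact
  interpret ideal I R by fact
  interpret Q: ring "R Quot I" by (rule quotient_is_ring)
  have hom: "(+>\<^bsub>R\<^esub>) I \<in> Ring.ring_hom R (R Quot I)" by (rule rcos_ring_hom)
  show ?thesis
  proof (rule moduleI)
    show "cring R" by fact
    show "abelian_group (quotient_module R I)"
    proof (rule abelian_groupI)
      fix x assume "x \<in> carrier (quotient_module R I)"
      then show "\<exists>y\<in>carrier (quotient_module R I).
          y \<oplus>\<^bsub>quotient_module R I\<^esub> x = \<zero>\<^bsub>quotient_module R I\<^esub>"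
        by (auto simp: quotient_module_def intro!: bexI[of _ "\<ominus>\<^bsub>R Quot I\<^esub> x"] Q.l_neg)
    qed (auto simp: quotient_module_def Q.a_ac)
  qed (use hom in \<open>auto simp: quotient_module_def ring_hom_closed ring_hom_add ring_hom_mult
        ring_hom_one Q.l_distr Q.r_distr Q.m_assoc\<close>)
qed

lemma vectorspace_restrict_scalars:
  assumes "module (mpoly_ring n) M"
  shows "vectorspace (class_ring :: 'k::field ring) (restrict_scalars mconst M)"
proof -
  interpret Module.module "mpoly_ring n :: 'k mpoly ring" M by fact
  have const: "mconst c \<in> carrier (mpoly_ring n)" for c :: 'k
    by (simp add: mconst_def mpoly_ring_def)
  have const_add: "mconst (c + d) = mconst c \<oplus>\<^bsub>mpoly_ring n\<^esub> mconst d" for c d :: 'k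
    by (simp add: mconst_def mpoly_ring_def single_add)
  have const_mult: "mconst (c * d) = mconst c \<otimes>\<^bsub>mpoly_ring n\<^esub> mconst d" for c d :: 'k
    by (simp add: mconst_def mpoly_ring_def mult_single)
  have const_one: "mconst (1 :: 'k) = \<one>\<^bsub>mpoly_ring n\<^esub>"
    by (simp add: mconst_def mpoly_ring_def)
  have "module (class_ring :: 'k ring) (restrict_scalars mconst M)"
  proof (rule moduleI)
    show "cring (class_ring :: 'k ring)" by (rule class_cring.is_cring)
    show "abelian_group (restrict_scalars mconst M)"
    proof (rule abelian_groupI)
      fix x assume "x \<in> carrier (restrict_scalars mconst M)"
      then show "\<exists>y\<in>carrier (restrict_scalars mconst M).
          y \<oplus>\<^bsub>restrict_scalars mconst M\<^esub> x = \<zero>\<^bsub>restrict_scalars mconst M\<^esub>"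
        by (auto simp: restrict_scalars_def intro!: bexI[of _ "\<ominus>\<^bsub>M\<^esub> x"] M.l_neg)
    qed (auto simp: restrict_scalars_def M.a_ac)
  qed (auto simp: restrict_scalars_def const const_add const_mult const_one
      smult_l_distr smult_r_distr smult_assoc1)
  then show ?thesis
    by (intro vectorspace.intro class_field)
qed


section \<open>Outside corner elements, \<open>\<RR>(M)\<close> and the socle\<close>

definition outside_corner_elements ::
    "nat \<Rightarrow> ('k::field mpoly, 'm, 'c) module_scheme \<Rightarrow> 'm set" where
  "outside_corner_elements n M = {m \<in> carrier M. \<forall>i\<in>{1..n}. mvar i \<odot>\<^bsub>M\<^esub> m = \<zero>\<^bsub>M\<^esub>}"

definition frak_R :: "('a, 'b) ring_scheme \<Rightarrow> ('a, 'm, 'c) module_scheme \<Rightarrow> 'm set" where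
  "frak_R R M = {m \<in> carrier M. \<forall>a\<in>carrier R.
     (a [^]\<^bsub>R\<^esub> (2::nat)) \<odot>\<^bsub>M\<^esub> m = \<zero>\<^bsub>M\<^esub> \<longrightarrow> a \<odot>\<^bsub>M\<^esub> m = \<zero>\<^bsub>M\<^esub>}"

definition max_ideal :: "nat \<Rightarrow> 'k::field mpoly set" where
  "max_ideal n = Idl\<^bsub>mpoly_ring n\<^esub> (mvar ` {1..n})"

definition Soc :: "nat \<Rightarrow> ('k::field mpoly, 'm, 'c) module_scheme \<Rightarrow> 'm set" where
  "Soc n M = {m \<in> carrier M. \<forall>a\<in>max_ideal n. a \<odot>\<^bsub>M\<^esub> m = \<zero>\<^bsub>M\<^esub>}"

end

theory Submission
  imports Defs
begin

text \<open>The annihilator of an element is an ideal, so the outside corner elements are exactly the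
  socle, which is already a \<open>k\<close>-subspace.  A scalar plus an element of \<open>\<langle>x\<^sub>1,\<dots>,x\<^sub>n\<rangle>\<close> acts on the
  socle as that scalar, whence the socle lies in \<open>\<RR>(M)\<close>.  Conversely, a linear dependence among
  the classes of the powers of \<open>x\<^sub>i\<close> is a polynomial in the monomial ideal \<open>I\<close>, so some power of
  \<open>x\<^sub>i\<close> lies in \<open>I\<close>; repeatedly halving the exponent by means of the defining property of
  \<open>\<RR>(M)\<close> shows that \<open>x\<^sub>i\<close> kills \<open>\<RR>(M)\<close>.\<close>

section \<open>Arithmetic of the polynomial ring as a record\<close>

lemma mpoly_ring_simps [simp]:
  "carrier (mpoly_ring n) =
     {p :: 'k::field mpoly. \<forall>t\<in>Poly_Mapping.keys p. Poly_Mapping.keys t \<subseteq> {1..n}}"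
  "mult (mpoly_ring n :: 'k mpoly ring) = (*)" "one (mpoly_ring n :: 'k mpoly ring) = 1"
  "zero (mpoly_ring n :: 'k mpoly ring) = 0" "add (mpoly_ring n :: 'k mpoly ring) = (+)"
  by (simp_all add: mpoly_ring_def)

lemma a_inv_mpoly_ring:
  assumes "p \<in> carrier (mpoly_ring n)"
  shows "a_inv (mpoly_ring n) p = - (p :: 'k::field mpoly)"
proof -
  interpret cring "mpoly_ring n :: 'k mpoly ring" by (rule cring_mpoly_ring)
  show ?thesis
    using assms by (intro minus_equality) auto
qed

lemma mvar_pow:
  "mvar i [^]\<^bsub>mpoly_ring n\<^esub> (j::nat)
     = (Poly_Mapping.single (Poly_Mapping.single i j) 1 :: 'k::field mpoly)"
  by (induction j)
    (simp_all add: mvar_def nat_pow_def mult_single single_add[symmetric] one_poly_mapping_def)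

section \<open>Monomial ideals contain the monomials of their elements\<close>

text \<open>Every exponent of \<open>p * q\<close> is a sum \<open>a + b\<close> of exponents of
  \<open>p\<close> and \<open>q\<close>, so its monomial is a multiple of the monomial of
  \<open>b\<close>, which lies in \<open>I\<close>. The set is the largest monomial ideal inside
  \<open>I\<close>.\<close>

lemma ideal_monomial_support:
  assumes "ideal I (mpoly_ring n :: 'k::field mpoly ring)"
  shows "ideal {p \<in> carrier (mpoly_ring n). \<forall>t\<in>Poly_Mapping.keys p. Poly_Mapping.single t 1 \<in> I}
           (mpoly_ring n :: 'k mpoly ring)" (is "ideal ?J ?R")
proof -
  interpret R: cring ?R by (rule cring_mpoly_ring)
  interpret I: ideal I ?R by fact
  have J: "p \<in> ?J \<longleftrightarrow> p \<in> carrier ?R \<and> (\<forall>t\<in>Poly_Mapping.keys p. Poly_Mapping.single t 1 \<in> I)"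
    for p by simp
  have mult: "p \<otimes>\<^bsub>?R\<^esub> q \<in> ?J" if p: "p \<in> carrier ?R" and q: "q \<in> ?J" for p q
  proof -
    have "Poly_Mapping.single t 1 \<in> I" if t: "t \<in> Poly_Mapping.keys (p * q)" for t
    proof -
      obtain a b where ab: "t = a + b" "a \<in> Poly_Mapping.keys p" "b \<in> Poly_Mapping.keys q"
        using t keys_mult[of p q] by blast
      have "Poly_Mapping.single a 1 \<otimes>\<^bsub>?R\<^esub> Poly_Mapping.single b 1 \<in> I"
        using ab p q by (intro I.I_l_closed) auto
      then show ?thesis by (simp add: ab mult_single)
    qed
    moreover have "p \<otimes>\<^bsub>?R\<^esub> q \<in> carrier ?R" using p q by (intro R.m_closed) auto
    ultimately show ?thesis unfolding J by simp
  qed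
  show ?thesis
  proof (rule idealI)
    show "ring ?R" by (rule R.ring_axioms)
    show "subgroup ?J (add_monoid ?R)"
    proof (rule R.add.subgroupI)
      show "?J \<subseteq> carrier ?R" by blast
      show "?J \<noteq> {}" by (auto intro!: exI[of _ 0])
      fix p assume p: "p \<in> ?J"
      then have "a_inv ?R p = - p" using a_inv_mpoly_ring J by blast
      then show "\<ominus>\<^bsub>?R\<^esub> p \<in> ?J" using p by simp
      fix q assume q: "q \<in> ?J"
      have "p + q \<in> carrier ?R" using p q R.a_closed[of p q] J by simp
      moreover have "Poly_Mapping.keys (p + q) \<subseteq> Poly_Mapping.keys p \<union> Poly_Mapping.keys q"
        by (rule keys_add)
      ultimately have "p + q \<in> ?J" using p q unfolding J by blast
      then show "p \<oplus>\<^bsub>?R\<^esub> q \<in> ?J" by simp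
    qed
    fix a x assume "a \<in> ?J" "x \<in> carrier ?R"
    then show x: "x \<otimes>\<^bsub>?R\<^esub> a \<in> ?J" by (rule mult[rotated])
    have "a \<otimes>\<^bsub>?R\<^esub> x = x \<otimes>\<^bsub>?R\<^esub> a" by (simp add: mult.commute)
    with x show "a \<otimes>\<^bsub>?R\<^esub> x \<in> ?J" by metis
  qed
qed

lemma ideal_if_monomial_ideal:
  assumes "monomial_ideal n I"
  shows "ideal I (mpoly_ring n :: 'k::field mpoly ring)"
proof -
  interpret R: cring "mpoly_ring n :: 'k mpoly ring" by (rule cring_mpoly_ring)
  have "monomials n \<subseteq> carrier (mpoly_ring n :: 'k mpoly ring)"
    by (auto simp: monomials_def)
  then show ?thesis
    using assms R.genideal_ideal unfolding monomial_ideal_def by blast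
qed

text \<open>A generator has only itself as a monomial, so all of \<open>G\<close> lies in the ideal
  of \<open>ideal_monomial_support\<close>. As \<open>I\<close> is the least ideal containing
  \<open>G\<close>, it lies there too.\<close>

lemma monomial_ideal_monomial_mem:
  assumes I: "monomial_ideal n I" and "p \<in> I" "t \<in> Poly_Mapping.keys p"
  shows "Poly_Mapping.single t (1::'k::field) \<in> I"
proof -
  let ?R = "mpoly_ring n :: 'k mpoly ring"
  interpret R: cring ?R by (rule cring_mpoly_ring)
  obtain G where G: "G \<subseteq> monomials n" "I = Idl\<^bsub>?R\<^esub> G"
    using I unfolding monomial_ideal_def by blast
  have car: "G \<subseteq> carrier ?R" using G(1) by (fastforce simp: monomials_def)
  have "G \<subseteq> I" unfolding G by (rule R.genideal_self[OF car])
  then have "G \<subseteq> {p \<in> carrier ?R. \<forall>t\<in>Poly_Mapping.keys p. Poly_Mapping.single t 1 \<in> I}"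
    using G(1) car by (fastforce simp: monomials_def)
  then have "I \<subseteq> {p \<in> carrier ?R. \<forall>t\<in>Poly_Mapping.keys p. Poly_Mapping.single t 1 \<in> I}"
    unfolding G(2)
    by (intro R.genideal_minimal ideal_monomial_support) (use car R.genideal_ideal in blast)+
  with assms(2,3) show ?thesis by blast
qed

section \<open>Finite codimension puts a power of each variable into the ideal\<close>

lemma quotient_module_smult_coset:
  assumes "ideal I R" "a \<in> carrier R" "b \<in> carrier R"
  shows "a \<odot>\<^bsub>quotient_module R I\<^esub> (I +>\<^bsub>R\<^esub> b) = I +>\<^bsub>R\<^esub> (a \<otimes>\<^bsub>R\<^esub> b)"
  using ideal.rcos_ring_hom[OF assms(1)] assms(2,3)
  by (simp add: quotient_module_def ring_hom_mult)

lemma mconst_closed: "mconst c \<in> carrier (mpoly_ring n)"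
  by (simp add: mconst_def)

text \<open>Turns a linear combination of classes of monomials into the class of one polynomial, so
  that a linear relation in the quotient can be read as membership in \<open>I\<close>.\<close>

lemma finsum_restrict_scalars_cosets:
  fixes n :: nat and I :: "'k::field mpoly set" and c :: "nat \<Rightarrow> 'k"
  defines "V \<equiv> restrict_scalars mconst (quotient_module (mpoly_ring n) I)"
  assumes I: "ideal I (mpoly_ring n)" and "finite F"
    and t: "\<And>j. Poly_Mapping.keys (t j) \<subseteq> {1..n}"
  shows "(\<Oplus>\<^bsub>V\<^esub>j\<in>F. c j \<odot>\<^bsub>V\<^esub> (I +>\<^bsub>mpoly_ring n\<^esub> Poly_Mapping.single (t j) 1))
           = I +>\<^bsub>mpoly_ring n\<^esub> (\<Sum>j\<in>F. Poly_Mapping.single (t j) (c j))"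
proof -
  let ?R = "mpoly_ring n :: 'k mpoly ring"
  interpret R: cring ?R by (rule cring_mpoly_ring)
  interpret I: ideal I ?R by fact
  interpret V: vectorspace "class_ring :: 'k ring" V
    unfolding V_def using cring_mpoly_ring I
    by (intro vectorspace_restrict_scalars[of n] module_quotient_module)
  have hom: "(+>\<^bsub>?R\<^esub>) I \<in> Ring.ring_hom ?R (?R Quot I)" by (rule I.rcos_ring_hom)
  have car: "Poly_Mapping.single (t j) d \<in> carrier ?R" for j d
    using t by simp
  have scaled: "c j \<odot>\<^bsub>V\<^esub> (I +>\<^bsub>?R\<^esub> Poly_Mapping.single (t j) 1)
      = I +>\<^bsub>?R\<^esub> Poly_Mapping.single (t j) (c j)" for j
  proof -
    have "c j \<odot>\<^bsub>V\<^esub> (I +>\<^bsub>?R\<^esub> Poly_Mapping.single (t j) 1)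
        = I +>\<^bsub>?R\<^esub> (mconst (c j) \<otimes>\<^bsub>?R\<^esub> Poly_Mapping.single (t j) 1)"
      using quotient_module_smult_coset[OF I mconst_closed car]
      by (simp add: V_def restrict_scalars_def)
    then show ?thesis by (simp add: mconst_def mult_single)
  qed
  have V_car: "I +>\<^bsub>?R\<^esub> p \<in> carrier V" if "p \<in> carrier ?R" for p
    using ring_hom_closed[OF hom that]
    by (simp add: V_def restrict_scalars_def quotient_module_def)
  have V_add: "(I +>\<^bsub>?R\<^esub> p) \<oplus>\<^bsub>V\<^esub> (I +>\<^bsub>?R\<^esub> q) = I +>\<^bsub>?R\<^esub> (p + q)"
    if "p \<in> carrier ?R" "q \<in> carrier ?R" for p q
    using ring_hom_add[OF hom that]
    by (simp add: V_def restrict_scalars_def quotient_module_def)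
  \<comment> \<open>The zero of the quotient is \<open>I\<close> itself; as the coset of
    \<open>0\<close> it matches the empty sum at the start of the induction.\<close>
  have V_zero: "\<zero>\<^bsub>V\<^esub> = I +>\<^bsub>?R\<^esub> 0"
    using R.a_rcos_zero[OF I additive_subgroup.zero_closed[OF I.additive_subgroup_axioms]]
    by (simp add: V_def restrict_scalars_def quotient_module_def FactRing_def)
  have sum_car: "(\<Sum>j\<in>G. Poly_Mapping.single (t j) (c j)) \<in> carrier ?R" for G
    by (induction G rule: infinite_finite_induct)
      (use car R.a_closed in \<open>simp_all del: mpoly_ring_simps(1) add: R.zero_closed[simplified]\<close>)
  show ?thesis
    using \<open>finite F\<close>
    by (induction F)
      (simp_all del: mpoly_ring_simps(1) add: V_zero scaled V_car V_add car sum_car)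
qed

lemma power_in_finite_codim_monomial_ideal:
  fixes n :: nat and I :: "'k::field mpoly set"
  defines "V \<equiv> restrict_scalars mconst (quotient_module (mpoly_ring n) I)"
  assumes I: "monomial_ideal n I" and fin: "vectorspace.fin_dim (class_ring :: 'k ring) V"
    and i: "i \<in> {1..n}"
  shows "\<exists>j. Poly_Mapping.single (Poly_Mapping.single i j) 1 \<in> I"
proof -
  let ?R = "mpoly_ring n :: 'k mpoly ring"
  let ?x = "\<lambda>j. Poly_Mapping.single (Poly_Mapping.single i (j::nat)) (1::'k)"
  let ?f = "\<lambda>j. I +>\<^bsub>?R\<^esub> ?x j"
  have idl: "ideal I ?R" by (rule ideal_if_monomial_ideal[OF I])
  interpret R: cring ?R by (rule cring_mpoly_ring)
  interpret I: ideal I ?R by fact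
  interpret V: vectorspace "class_ring :: 'k ring" V
    unfolding V_def using cring_mpoly_ring idl
    by (intro vectorspace_restrict_scalars[of n] module_quotient_module)
  have key: "Poly_Mapping.keys (Poly_Mapping.single i (j::nat)) \<subseteq> {1..n}" for j
    using i by simp
  then have car: "?x j \<in> carrier ?R" for j by simp
  have single_eq: "Poly_Mapping.single i j = Poly_Mapping.single i k \<longleftrightarrow> j = k" for j k :: nat
    by (metis lookup_single_eq)
  show ?thesis
  \<comment> \<open>Linear dependence is a property of sets, not of families. If two powers have the
    same class, their coincidence is itself the relation and is treated separately.\<close>
  proof (cases "inj ?f")
    case False
    then obtain j k where jk: "j \<noteq> k" "?f j = ?f k" unfolding inj_def by blast
    then have "?x j \<ominus>\<^bsub>?R\<^esub> ?x k \<in> I"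
      using R.quotient_eq_iff_same_a_r_cos[OF idl car car] by blast
    then have "?x j - ?x k \<in> I"
      using a_inv_mpoly_ring[OF car] by (simp add: a_minus_def)
    \<comment> \<open>Since \<open>j\<close> and \<open>k\<close> differ, this coefficient is
      1.\<close>
    moreover have "Poly_Mapping.single i j \<in> Poly_Mapping.keys (?x j - ?x k)"
      using jk by (simp add: in_keys_iff lookup_minus lookup_single single_eq)
    ultimately show ?thesis using monomial_ideal_monomial_mem[OF I] by blast
  next
    case True
    have "range ?f \<subseteq> carrier V"
      using ring_hom_closed[OF I.rcos_ring_hom car]
      by (auto simp: V_def restrict_scalars_def quotient_module_def)
    moreover have "infinite (range ?f)" using True range_inj_infinite by blast
    \<comment> \<open>By contraposition: a linearly independent subset of a finite-dimensional space
      is finite.\<close>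
    ultimately have "V.lin_dep (range ?f)" using V.li_le_dim(1)[OF fin] by blast
    then obtain A a v where A: "finite A" "A \<subseteq> range ?f" "V.lincomb a A = \<zero>\<^bsub>V\<^esub>"
        "v \<in> A" "a v \<noteq> 0"
      unfolding V.lin_dep_def by (auto simp: class_ring_simps)
    \<comment> \<open>The relation is indexed by cosets; injectivity of \<open>?f\<close> allows
      reindexing it by the exponents \<open>F\<close>.\<close>
    define F where "F = ?f -` A"
    have F: "finite F" "A = ?f ` F"
      using A(1,2) True unfolding F_def by (auto intro: finite_vimageI)
    have inj: "inj_on ?f F" using True by (rule inj_on_subset) simp
    let ?p = "\<Sum>j\<in>F. Poly_Mapping.single (Poly_Mapping.single i j) (a (?f j))"
    have "V.lincomb a A = (\<Oplus>\<^bsub>V\<^esub>j\<in>F. a (?f j) \<odot>\<^bsub>V\<^esub> ?f j)"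
      unfolding V.lincomb_def F(2)
      by (intro V.finsum_reindex inj)
        (use \<open>range ?f \<subseteq> carrier V\<close> in \<open>auto intro!: V.smult_closed simp: class_ring_simps\<close>)
    also have "\<dots> = I +>\<^bsub>?R\<^esub> ?p"
      unfolding V_def by (rule finsum_restrict_scalars_cosets[OF idl F(1) key])
    finally have "I +>\<^bsub>?R\<^esub> ?p = I"
      using A(3) by (simp add: V_def restrict_scalars_def quotient_module_def FactRing_def)
    moreover have "?p \<in> carrier ?R"
    proof -
      have "Poly_Mapping.keys ?p \<subseteq> (\<Union>j\<in>F. {Poly_Mapping.single i j})"
        by (rule order_trans[OF keys_sum]) (auto split: if_splits)
      then have "Poly_Mapping.keys t \<subseteq> {1..n}" if "t \<in> Poly_Mapping.keys ?p" for t
        using that key by blast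
      then show ?thesis by simp
    qed
    ultimately have "?p \<in> I" by (intro I.rcos_const_imp_mem)
    obtain k where k: "k \<in> F" "v = ?f k" using A(4) F(2) by blast
    \<comment> \<open>Different \<open>j\<close> give different exponents by
      \<open>single_eq\<close>, so no coefficients merge and the nonzero \<open>a v\<close>
      survives.\<close>
    have "Poly_Mapping.lookup ?p (Poly_Mapping.single i k) = a v"
      using F(1) k by (simp add: lookup_sum lookup_single single_eq when_def)
    then have "Poly_Mapping.single i k \<in> Poly_Mapping.keys ?p"
      using A(5) by (simp add: in_keys_iff)
    with \<open>?p \<in> I\<close> show ?thesis using monomial_ideal_monomial_mem[OF I] by blast
  qed
qed

section \<open>Annihilators, and outside corner elements as the socle\<close>

text \<open>Serves to pass from generators to the ideal they generate: if the generators kill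
  \<open>m\<close>, minimality of the generated ideal shows that all of it does.\<close>

lemma (in Module.module) ideal_annihilator:
  assumes "m \<in> carrier M"
  shows "ideal {a \<in> carrier R. a \<odot>\<^bsub>M\<^esub> m = \<zero>\<^bsub>M\<^esub>} R"
proof (rule idealI)
  show "ring R" by (rule R.ring_axioms)
  show "subgroup {a \<in> carrier R. a \<odot>\<^bsub>M\<^esub> m = \<zero>\<^bsub>M\<^esub>} (add_monoid R)"
    using assms
    by (intro R.add.subgroupI)
      (auto simp: smult_l_distr smult_l_minus a_inv_def[symmetric] intro: exI[of _ "\<zero>"])
  fix a x assume a: "a \<in> {a \<in> carrier R. a \<odot>\<^bsub>M\<^esub> m = \<zero>\<^bsub>M\<^esub>}" and x: "x \<in> carrier R"
  then show xa: "x \<otimes> a \<in> {a \<in> carrier R. a \<odot>\<^bsub>M\<^esub> m = \<zero>\<^bsub>M\<^esub>}"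
    using assms by (simp add: smult_assoc1)
  have "a \<otimes> x = x \<otimes> a" using a x by (simp add: R.m_comm)
  with xa show "a \<otimes> x \<in> {a \<in> carrier R. a \<odot>\<^bsub>M\<^esub> m = \<zero>\<^bsub>M\<^esub>}" by simp
qed


lemma mvar_image_closed: "mvar ` {1..n} \<subseteq> carrier (mpoly_ring n :: 'k::field mpoly ring)"
  by (auto simp: mvar_def)

lemma ideal_max_ideal: "ideal (max_ideal n) (mpoly_ring n :: 'k::field mpoly ring)"
proof -
  interpret R: cring "mpoly_ring n :: 'k mpoly ring" by (rule cring_mpoly_ring)
  show ?thesis
    unfolding max_ideal_def by (rule R.genideal_ideal[OF mvar_image_closed])
qed

lemma mvar_mem_max_ideal:
  assumes "i \<in> {1..n}"
  shows "mvar i \<in> (max_ideal n :: 'k::field mpoly set)"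
proof -
  interpret R: cring "mpoly_ring n :: 'k mpoly ring" by (rule cring_mpoly_ring)
  show ?thesis
    using assms R.genideal_self[OF mvar_image_closed] unfolding max_ideal_def by blast
qed

lemma outside_corner_elements_eq_Soc:
  fixes M :: "('k::field mpoly, 'm, 'c) module_scheme"
  assumes "module (mpoly_ring n) M"
  shows "outside_corner_elements n M = Soc n M"
proof -
  let ?R = "mpoly_ring n :: 'k mpoly ring"
  interpret Module.module ?R M by fact
  have "max_ideal n \<subseteq> {a \<in> carrier ?R. a \<odot>\<^bsub>M\<^esub> m = \<zero>\<^bsub>M\<^esub>}"
    if "m \<in> outside_corner_elements n M" for m
    unfolding max_ideal_def using that mvar_image_closed[where 'k = 'k]
    by (intro R.genideal_minimal ideal_annihilator)
      (auto simp del: mpoly_ring_simps(1) simp: outside_corner_elements_def)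
  then show ?thesis
    using mvar_mem_max_ideal[where 'k = 'k]
    unfolding Soc_def outside_corner_elements_def by blast
qed

section \<open>Splitting off the constant term; the socle lies in \<open>frak_R\<close>\<close>

text \<open>A monomial with nonzero exponent is divisible by some variable; the polynomial is then
  assembled one term at a time.\<close>

lemma mem_max_idealI:
  fixes p :: "'k::field mpoly"
  assumes "\<And>t. t \<in> Poly_Mapping.keys p \<Longrightarrow> t \<noteq> 0 \<and> Poly_Mapping.keys t \<subseteq> {1..n}"
  shows "p \<in> max_ideal n"
  using assms
proof (induction p rule: update_induct)
  case const
  interpret ideal "max_ideal n" "mpoly_ring n :: 'k mpoly ring" by (rule ideal_max_ideal)
  show ?case using additive_subgroup.zero_closed[OF additive_subgroup_axioms] by simp
next
  case (update p t c)
  interpret ideal "max_ideal n" "mpoly_ring n :: 'k mpoly ring" by (rule ideal_max_ideal)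
  have keys: "Poly_Mapping.keys (Poly_Mapping.update t c p) = insert t (Poly_Mapping.keys p)"
    using update.hyps by (simp add: keys_update)
  then have t: "t \<noteq> 0" "Poly_Mapping.keys t \<subseteq> {1..n}" and p: "p \<in> max_ideal n"
    using update by auto
  obtain i where i: "i \<in> Poly_Mapping.keys t" using t(1) by fastforce
  \<comment> \<open>The exponent of the cofactor after dividing by the variable \<open>i\<close>.
    Subtraction on \<open>nat\<close> truncates, but \<open>i\<close> occurs in \<open>t\<close>
    with exponent at least 1, so nothing is lost.\<close>
  define s where "s = t - Poly_Mapping.single i 1"
  have ts: "t = s + Poly_Mapping.single i 1"
    using i unfolding s_def
    by (intro poly_mapping_eqI)
      (auto simp: lookup_add lookup_minus lookup_single in_keys_iff when_def)
  have "Poly_Mapping.keys s \<subseteq> {1..n}"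
    using t(2) by (auto simp: s_def in_keys_iff lookup_minus subset_iff)
  then have "Poly_Mapping.single s c \<otimes>\<^bsub>mpoly_ring n\<^esub> mvar i \<in> max_ideal n"
    using i t(2) by (intro I_l_closed mvar_mem_max_ideal) auto
  then have "Poly_Mapping.single t c \<in> max_ideal n"
    by (simp add: ts mvar_def mult_single)
  then have "p + Poly_Mapping.single t c \<in> max_ideal n"
    using additive_subgroup.a_closed[OF additive_subgroup_axioms p] by simp
  \<comment> \<open>Updating agrees with adding because \<open>t\<close> is not yet an exponent of
    \<open>p\<close>.\<close>
  moreover have "Poly_Mapping.update t c p = p + Poly_Mapping.single t c"
    using update.hyps
    by (intro poly_mapping_eqI)
      (auto simp: lookup_update lookup_add lookup_single in_keys_iff when_def)
  ultimately show ?case by simp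
qed

text \<open>The coefficient at exponent \<open>0\<close> is the constant term, and removing it
  leaves only nonzero exponents. Hence the ring is the sum of the constants and
  \<open>max_ideal n\<close>.\<close>

lemma minus_const_mem_max_ideal:
  fixes p :: "'k::field mpoly"
  assumes "p \<in> carrier (mpoly_ring n)"
  shows "p - mconst (Poly_Mapping.lookup p 0) \<in> max_ideal n"
  using assms
  by (intro mem_max_idealI)
    (auto simp: mconst_def in_keys_iff lookup_minus lookup_single when_def subset_iff
      split: if_splits)

lemma Soc_subset_frak_R:
  fixes M :: "('k::field mpoly, 'm, 'c) module_scheme"
  assumes "module (mpoly_ring n) M"
  shows "Soc n M \<subseteq> frak_R (mpoly_ring n) M"
proof
  let ?R = "mpoly_ring n :: 'k mpoly ring"
  interpret Module.module ?R M by fact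
  interpret J: ideal "max_ideal n" ?R by (rule ideal_max_ideal)
  fix m assume m: "m \<in> Soc n M"
  then have m_car: "m \<in> carrier M" by (simp add: Soc_def)
  have "a \<odot>\<^bsub>M\<^esub> m = \<zero>\<^bsub>M\<^esub>"
    if a: "a \<in> carrier ?R" and sq: "(a [^]\<^bsub>?R\<^esub> (2::nat)) \<odot>\<^bsub>M\<^esub> m = \<zero>\<^bsub>M\<^esub>" for a
  proof -
    define c where "c = Poly_Mapping.lookup a 0"
    define b where "b = a - mconst c"
    have b: "b \<in> max_ideal n"
      unfolding b_def c_def by (rule minus_const_mem_max_ideal[OF a])
    have a_eq: "a = mconst c \<oplus>\<^bsub>?R\<^esub> b" by (simp add: b_def)
    have const: "mconst d \<in> carrier ?R" for d by (rule mconst_closed)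
    \<comment> \<open>The summand \<open>b\<close> lies in \<open>max_ideal n\<close> and therefore
      kills the socle element \<open>m\<close>.\<close>
    have act: "a \<odot>\<^bsub>M\<^esub> m = mconst c \<odot>\<^bsub>M\<^esub> m"
      unfolding a_eq using smult_l_distr[OF const J.Icarr[OF b] m_car] m b m_car const
      by (simp del: mpoly_ring_simps add: Soc_def)
    show ?thesis
    proof (cases "c = 0")
      case True
      then have "a = b" by (simp add: b_def mconst_def)
      then show ?thesis using m b by (simp add: Soc_def)
    next
      case False
      \<comment> \<open>One factor \<open>a\<close> of the square is replaced by its constant term
        \<open>c\<close>, which is invertible here and can be cancelled from
        \<open>c (a m) = 0\<close>.\<close>
      have "(a [^]\<^bsub>?R\<^esub> (2::nat)) \<odot>\<^bsub>M\<^esub> m = a \<odot>\<^bsub>M\<^esub> (a \<odot>\<^bsub>M\<^esub> m)"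
        using a m_car by (simp del: mpoly_ring_simps add: R.nat_pow_Suc numeral_2_eq_2 smult_assoc1)
      also have "\<dots> = mconst c \<odot>\<^bsub>M\<^esub> (a \<odot>\<^bsub>M\<^esub> m)"
        using act smult_assoc1[OF a const m_car] smult_assoc1[OF const a m_car]
          R.m_comm[OF a const] by metis
      finally have "mconst c \<odot>\<^bsub>M\<^esub> (a \<odot>\<^bsub>M\<^esub> m) = \<zero>\<^bsub>M\<^esub>" using sq by simp
      then have "mconst (inverse c) \<odot>\<^bsub>M\<^esub> (mconst c \<odot>\<^bsub>M\<^esub> (a \<odot>\<^bsub>M\<^esub> m)) = \<zero>\<^bsub>M\<^esub>"
        using const by simp
      then have "(mconst (inverse c) \<otimes>\<^bsub>?R\<^esub> mconst c) \<odot>\<^bsub>M\<^esub> (a \<odot>\<^bsub>M\<^esub> m) = \<zero>\<^bsub>M\<^esub>"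
        by (subst smult_assoc1[OF const const smult_closed[OF a m_car]])
      moreover have "mconst (inverse c) \<otimes>\<^bsub>?R\<^esub> mconst c = \<one>\<^bsub>?R\<^esub>"
        using False by (simp add: mconst_def mult_single)
      ultimately show ?thesis using smult_one[OF smult_closed[OF a m_car]] by metis
    qed
  qed
  then show "m \<in> frak_R ?R M" using m_car by (simp add: frak_R_def)
qed

section \<open>Powers of the variables force \<open>frak_R\<close> into the outside corner
  elements\<close>

text \<open>The defining property, applied to \<open>a [^] l\<close> instead of \<open>a\<close>,
  brings the exponent \<open>2 * l\<close> down to \<open>l\<close>; strong induction repeats this
  until the exponent is at most 1.\<close>

lemma (in Module.module) frak_R_pow_annihilates:
  assumes m: "m \<in> frak_R R M" and a: "a \<in> carrier R" and "(a [^] (k::nat)) \<odot>\<^bsub>M\<^esub> m = \<zero>\<^bsub>M\<^esub>"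
  shows "a \<odot>\<^bsub>M\<^esub> m = \<zero>\<^bsub>M\<^esub>"
  using assms(3)
proof (induction k rule: less_induct)
  case (less k)
  have car: "m \<in> carrier M" using m by (simp add: frak_R_def)
  \<comment> \<open>Halving with rounding up fixes \<open>k = 1\<close>, so this is a base case; for
    \<open>k = 0\<close> the premise says that \<open>m\<close> is zero.\<close>
  consider "k = 0" | "k = 1" | "k \<ge> 2" by linarith
  then show ?case
  proof cases
    case 1
    then show ?thesis using less.prems car a by simp
  next
    case 2
    then show ?thesis using less.prems a by simp
  next
    case 3
    \<comment> \<open>Half of \<open>k\<close>, rounded up so that \<open>2 * l\<close> is at least
      \<open>k\<close>; the excess \<open>2 * l - k\<close> is 0 or 1.\<close>
    define l where "l = (k + 1) div 2"
    have "(a [^] l) [^] (2::nat) = a [^] (2 * l - k) \<otimes> a [^] k"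
      using a by (simp add: R.nat_pow_pow R.nat_pow_mult l_def mult.commute)
    then have "((a [^] l) [^] (2::nat)) \<odot>\<^bsub>M\<^esub> m = \<zero>\<^bsub>M\<^esub>"
      using less.prems a car by (simp add: smult_assoc1)
    then have "(a [^] l) \<odot>\<^bsub>M\<^esub> m = \<zero>\<^bsub>M\<^esub>" using m a by (simp add: frak_R_def)
    moreover have "l < k" using 3 by (simp add: l_def)
    ultimately show ?thesis by (rule less.IH[rotated])
  qed
qed

text \<open>Finite dimension enters here: some power of each variable lies in \<open>I\<close>,
  hence kills the whole quotient, and for elements of \<open>frak_R\<close> the power can be lowered
  to the variable itself.\<close>

lemma frak_R_subset_outside_corner_elements:
  fixes I :: "'k::field mpoly set"
  assumes I: "monomial_ideal n I"
    and "vectorspace.fin_dim (class_ring :: 'k ring)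
      (restrict_scalars mconst (quotient_module (mpoly_ring n) I))"
  shows "frak_R (mpoly_ring n) (quotient_module (mpoly_ring n) I)
    \<subseteq> outside_corner_elements n (quotient_module (mpoly_ring n) I)"
proof
  let ?R = "mpoly_ring n :: 'k mpoly ring"
  let ?M = "quotient_module ?R I"
  have idl: "ideal I ?R" by (rule ideal_if_monomial_ideal[OF I])
  interpret Module.module ?R ?M by (rule module_quotient_module[OF cring_mpoly_ring idl])
  interpret I: ideal I ?R by fact
  fix m assume m: "m \<in> frak_R ?R ?M"
  have "mvar i \<odot>\<^bsub>?M\<^esub> m = \<zero>\<^bsub>?M\<^esub>" if i: "i \<in> {1..n}" for i
  proof -
    obtain j where j: "Poly_Mapping.single (Poly_Mapping.single i j) 1 \<in> I"
      using power_in_finite_codim_monomial_ideal[OF assms i] by blast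
    have x: "mvar i \<in> carrier ?R" using i mvar_image_closed by blast
    have pow: "mvar i [^]\<^bsub>?R\<^esub> j \<in> I" using j by (simp add: mvar_pow)
    obtain p where p: "p \<in> carrier ?R" "m = I +>\<^bsub>?R\<^esub> p"
      using m by (auto simp: frak_R_def quotient_module_def FactRing_def A_RCOSETS_def')
    have "(mvar i [^]\<^bsub>?R\<^esub> j) \<odot>\<^bsub>?M\<^esub> m = I +>\<^bsub>?R\<^esub> (mvar i [^]\<^bsub>?R\<^esub> j \<otimes>\<^bsub>?R\<^esub> p)"
      unfolding p(2) by (rule quotient_module_smult_coset[OF idl I.Icarr[OF pow] p(1)])
    also have "\<dots> = \<zero>\<^bsub>?M\<^esub>"
      using R.a_rcos_zero[OF idl I.I_r_closed[OF pow p(1)]]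
      by (simp add: quotient_module_def FactRing_def)
    finally show ?thesis by (rule frak_R_pow_annihilates[OF m x])
  qed
  then show "m \<in> outside_corner_elements n ?M"
    using m by (simp add: frak_R_def outside_corner_elements_def)
qed

section \<open>The span of the outside corner elements, and the conclusion\<close>

text \<open>Multiplication by a variable is linear over the field, since constants commute with
  variables. The set is the common kernel of these maps, hence a subspace and its own span.\<close>

lemma span_outside_corner_elements:
  fixes M :: "('k::field mpoly, 'm, 'c) module_scheme"
  assumes "module (mpoly_ring n) M"
  shows "LinearCombinations.module.span (class_ring :: 'k ring) (restrict_scalars mconst M)
    (outside_corner_elements n M) = outside_corner_elements n M" (is "_ = ?S")
proof -
  let ?R = "mpoly_ring n :: 'k mpoly ring"
  interpret Module.module ?R M by fact
  interpret V: vectorspace "class_ring :: 'k ring" "restrict_scalars mconst M"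
    by (rule vectorspace_restrict_scalars) fact
  have x: "mvar i \<in> carrier ?R" if "i \<in> {1..n}" for i
    using that mvar_image_closed by blast
  have const: "mconst c \<in> carrier ?R" for c by (rule mconst_closed)
  have "submodule (class_ring :: 'k ring) ?S (restrict_scalars mconst M)"
  proof
    show "?S \<subseteq> carrier (restrict_scalars mconst M)"
      by (auto simp: outside_corner_elements_def restrict_scalars_def)
    show "\<zero>\<^bsub>restrict_scalars mconst M\<^esub> \<in> ?S"
      using x by (simp add: outside_corner_elements_def restrict_scalars_def)
    fix v assume v: "v \<in> ?S"
    show "v \<oplus>\<^bsub>restrict_scalars mconst M\<^esub> w \<in> ?S" if "w \<in> ?S" for w
      using v that x by (simp add: outside_corner_elements_def restrict_scalars_def smult_r_distr)
    fix c :: 'k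
    have "mvar i \<odot>\<^bsub>M\<^esub> (mconst c \<odot>\<^bsub>M\<^esub> v) = \<zero>\<^bsub>M\<^esub>" if i: "i \<in> {1..n}" for i
    proof -
      have "mvar i \<odot>\<^bsub>M\<^esub> (mconst c \<odot>\<^bsub>M\<^esub> v) = mconst c \<odot>\<^bsub>M\<^esub> (mvar i \<odot>\<^bsub>M\<^esub> v)"
        using smult_assoc1[OF x[OF i] const] smult_assoc1[OF const x[OF i]]
          R.m_comm[OF x[OF i] const] v
        by (metis (no_types, lifting) mem_Collect_eq outside_corner_elements_def)
      then show ?thesis using v i const by (simp add: outside_corner_elements_def)
    qed
    then show "c \<odot>\<^bsub>restrict_scalars mconst M\<^esub> v \<in> ?S"
      using v const by (simp add: outside_corner_elements_def restrict_scalars_def)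
  qed
  then show ?thesis
    using V.span_is_subset[OF _ \<open>submodule _ _ _\<close>] V.in_own_span submodule.subset by blast
qed

theorem theorem2p1:
  fixes n :: nat
    and R :: "'k::field mpoly ring"
    and I :: "'k mpoly set"
    and M :: "('k mpoly, 'k mpoly set) module"
    and V :: "('k, 'k mpoly set) module"
  assumes "R = mpoly_ring n"
    and "monomial_ideal n I"
    and "M = quotient_module R I"
    and "V = restrict_scalars mconst M"
    and "vectorspace.fin_dim (class_ring :: 'k ring) V"
  shows "LinearCombinations.module.span (class_ring :: 'k ring) V (outside_corner_elements n M)
           = frak_R R M
       \<and> frak_R R M = Soc n M"
proof -
  have M: "module (mpoly_ring n) M"
    using assms module_quotient_module cring_mpoly_ring ideal_if_monomial_ideal by blast
  \<comment> \<open>The two inclusions and the equality of the outside corner elements with the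
    socle close a cycle; the span adds nothing new.\<close>
  have "frak_R R M \<subseteq> outside_corner_elements n M"
    using frak_R_subset_outside_corner_elements assms by blast
  moreover have "Soc n M \<subseteq> frak_R R M"
    using Soc_subset_frak_R[OF M] assms(1) by simp
  ultimately show ?thesis
    using outside_corner_elements_eq_Soc[OF M] span_outside_corner_elements[OF M] assms(4)
    by auto
qed

end
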